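(* Let $n\ge 3$, let $a_0,\ldots,a_{n-1}$ be indeterminates over $\mathbb{Q}$, $f=x^n+a_{n-1}x^{n-1}+\cdots+a_0$, and let \[f_1(x,y)=\frac{f(y)-f(x)}{y-x},\qquad f_3(x,y)=\frac{f(y)-2f\left(\frac{x+y}{2}\right)+f(x)}{\frac{(y-x)^2}{2}},\] $F=\operatorname{res}(f_1,f_3,y)$ and $E=\operatorname{res}(f,F,x)\in\mathbb{Q}[a_0,\ldots,a_{n-1}]$. Let $D_2\in\mathbb{Q}[a_0,\ldots,a_{n-1}]$ be the polynomial obtained by expressing $\prod_{1\le i,j,k\le n,\ i<j,\ j\ne k,\ k\ne i}(2r_k-r_i-r_j)$, where $r_1,\ldots,r_n$ are the roots of $f$, in terms of $a_0,\ldots,a_{n-1}$ via Vieta's formulas. Then $E=c\,D_2^2$ for some nonzero rational number $c$.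
   Context: The quotients defining $f_1,f_3$ are polynomials in $x,y$; $\operatorname{res}$ denotes the Sylvester resultant with respect to the indicated variable. *)

theory Defs
  imports "HOL-Library.Poly_Mapping" "HOL-Computational_Algebra.Polynomial"
    "Subresultants.Resultant_Prelim"
begin

text \<open>Multivariate polynomials over the rationals in variables a_0, a_1, ...:
  a monomial is a finitely supported exponent map nat to nat.\<close>
type_synonym mpoly = "(nat \<Rightarrow>\<^sub>0 nat) \<Rightarrow>\<^sub>0 rat"

definition Var :: "nat \<Rightarrow> mpoly" where
  "Var i = Poly_Mapping.single (Poly_Mapping.single i 1) 1"

definition Const :: "rat \<Rightarrow> mpoly" where
  "Const c = Poly_Mapping.single 0 c"

definition mvars :: "mpoly \<Rightarrow> nat set" where
  "mvars p = (\<Union>m\<in>Poly_Mapping.keys p. Poly_Mapping.keys m)"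

definition meval :: "(nat \<Rightarrow> complex) \<Rightarrow> mpoly \<Rightarrow> complex" where
  "meval v p = (\<Sum>m\<in>Poly_Mapping.keys p.
      of_rat (Poly_Mapping.lookup p m) * (\<Prod>i\<in>Poly_Mapping.keys m. v i ^ Poly_Mapping.lookup m i))"

definition gen_poly :: "nat \<Rightarrow> mpoly poly" where
  "gen_poly n = monom 1 n + (\<Sum>i<n. monom (Var i) i)"

text \<open>Bivariate polynomials in x,y: type mpoly poly poly, outer variable y, inner variable x.\<close>
definition varX :: "mpoly poly poly" where "varX = [:[:0, 1:]:]"
definition varY :: "mpoly poly poly" where "varY = [:0, 1:]"

text \<open>Lift a univariate polynomial over Q[a] so that it can be evaluated at bivariate polynomials.\<close>
definition lift2 :: "mpoly poly \<Rightarrow> mpoly poly poly poly" where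
  "lift2 p = map_poly (\<lambda>c. [:[:c:]:]) p"

end

theory Submission
  imports Defs "HOL-Library.FuncSet" "HOL-Computational_Algebra.Polynomial_FPS"
    "HOL-Computational_Algebra.Fundamental_Theorem_Algebra"
begin

text \<open>
  Specialise the coefficients to a complex polynomial with roots \<open>r\<^sub>1, \<dots>, r\<^sub>n\<close>. The resultant of a
  monic polynomial with \<open>q\<close> is the product of the values of \<open>q\<close> at the roots. Since
  \<open>f\<^sub>1(r\<^sub>i, y) = \<Prod>\<^sub>j\<^sub>\<noteq>\<^sub>i (y - r\<^sub>j)\<close> and \<open>f\<^sub>3(r\<^sub>i, r\<^sub>j) = \<Prod>\<^sub>k\<^sub>\<noteq>\<^sub>i\<^sub>,\<^sub>j ((r\<^sub>i + r\<^sub>j)/2 - r\<^sub>k)\<close>, the polynomial \<open>E\<close>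
  specialises to the product of \<open>(r\<^sub>i + r\<^sub>j)/2 - r\<^sub>k\<close> over all ordered triples of distinct indices,
  in which every factor of \<open>D\<^sub>2\<close> occurs twice up to the constant \<open>-1/2\<close>. By the fundamental theorem
  of algebra all specialisations are of this form, and a polynomial vanishing at all complex points
  is zero. The polynomial \<open>D\<^sub>2\<close> exists because the product over the roots equals its own average over
  all permutations, symmetrised monomials are polynomials in power sums, and these are polynomials
  in the coefficients by Newton's identities.
\<close>

section \<open>Resultants and roots\<close>

text \<open>The Newton interpolation basis with nodes \<open>a 0\<close>, \<open>a 1\<close>, and so
  on. The monic polynomial with roots \<open>a 0\<close>, ..., \<open>a (m - 1)\<close> is itself a
  member of this basis, which is what makes its resultant triangular.\<close>

definition newton_poly :: "(nat \<Rightarrow> 'a::comm_ring_1) \<Rightarrow> nat \<Rightarrow> 'a poly" where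
  "newton_poly a k = (\<Prod>l<k. [:- a l, 1:])"

lemma newton_poly_Suc: "newton_poly a (Suc k) = [:- a k, 1:] * newton_poly a k"
  by (simp add: newton_poly_def)

lemma degree_monic_newton_poly:
  "degree (newton_poly a k) \<le> k \<and> coeff (newton_poly a k) k = 1"
proof (induction k)
  case (Suc k)
  have "degree ([:- a k, 1:] * newton_poly a k) \<le> Suc k"
    using Suc degree_mult_le[of "[:- a k, 1:]" "newton_poly a k"] by (auto split: if_splits)
  moreover have "coeff (newton_poly a k) (Suc k) = 0"
    using Suc by (intro coeff_eq_0) auto
  ultimately show ?case
    using Suc by (simp add: newton_poly_Suc)
qed (simp add: newton_poly_def)

text \<open>Dividing \<open>g\<close> by \<open>x - a k\<close> leaves the remainder
  \<open>g (a k)\<close>, and the quotient, of smaller degree, is multiplied by the next Newton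
  polynomial. Iterating this is Newton interpolation started at node \<open>k\<close>.\<close>

lemma newton_poly_mult_expansion:
  assumes "degree g \<le> d"
  shows "\<exists>c. newton_poly a k * g = (\<Sum>l\<in>{k..k+d}. smult (c l) (newton_poly a l)) \<and> c k = poly g (a k)"
  using assms
proof (induction d arbitrary: k g)
  case 0
  then obtain b where "g = [:b:]" by (auto elim: degree_eq_zeroE)
  thus ?case by (intro exI[of _ "\<lambda>_. b"]) simp
next
  case (Suc d)
  define h where "h = synthetic_div g (a k)"
  have g: "g = [:poly g (a k):] + [:- a k, 1:] * h"
    using synthetic_div_correct'[of "a k" g] by (simp add: h_def algebra_simps)
  have "degree h \<le> d"
    using Suc.prems by (simp add: h_def degree_synthetic_div)
  then obtain c where c: "newton_poly a (Suc k) * h =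
      (\<Sum>l\<in>{Suc k..Suc k+d}. smult (c l) (newton_poly a l))"
    using Suc.IH by blast
  define c' where "c' = c(k := poly g (a k))"
  have "newton_poly a k * g = newton_poly a k * ([:poly g (a k):] + [:- a k, 1:] * h)"
    using g by simp
  also have "\<dots> = smult (poly g (a k)) (newton_poly a k) + newton_poly a (Suc k) * h"
    by (simp add: newton_poly_Suc algebra_simps)
  also have "\<dots> = smult (c' k) (newton_poly a k) +
      (\<Sum>l\<in>{Suc k..Suc k+d}. smult (c' l) (newton_poly a l))"
    unfolding c by (simp add: c'_def)
  also have "\<dots> = (\<Sum>l\<in>{k..k+Suc d}. smult (c' l) (newton_poly a l))"
    by (subst sum.atLeast_Suc_atMost[of k]) auto
  finally show ?case
    by (intro exI[of _ c']) (simp add: c'_def)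
qed

text \<open>Both indices run downwards to match the Sylvester matrix, whose rows start with the
  leading coefficients.\<close>

definition coeff_mat :: "nat \<Rightarrow> (nat \<Rightarrow> 'a::comm_ring_1 poly) \<Rightarrow> 'a mat" where
  "coeff_mat N F = mat N N (\<lambda>(i, j). coeff (F (N - 1 - i)) (N - 1 - j))"

text \<open>A change of generating family acts by left multiplication, so determinants of two
  families can be compared through the matrix of combination coefficients.\<close>

lemma coeff_mat_mult:
  assumes "\<And>i. i < N \<Longrightarrow> F i = (\<Sum>l<N. smult (c i l) (G l))"
  shows "coeff_mat N F = mat N N (\<lambda>(i, j). c (N - 1 - i) (N - 1 - j)) * coeff_mat N G"
proof (rule eq_matI; simp add: coeff_mat_def scalar_prod_def)
  fix i j assume ij: "i < N" "j < N"
  have "coeff (F (N - 1 - i)) (N - 1 - j) = (\<Sum>l<N. c (N - 1 - i) l * coeff (G l) (N - 1 - j))"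
    using ij by (subst assms) (auto simp: coeff_sum)
  also have "\<dots> = (\<Sum>l<N. c (N - 1 - i) (N - 1 - l) * coeff (G (N - 1 - l)) (N - 1 - j))"
    by (subst sum.nat_diff_reindex[symmetric]) simp
  finally show "coeff (F (N - Suc i)) (N - Suc j) =
      (\<Sum>l = 0..<N. c (N - Suc i) (N - Suc l) * coeff (G (N - Suc l)) (N - Suc j))"
    by (simp add: atLeast0LessThan)
qed

text \<open>Rewriting the Sylvester rows in the Newton basis: with \<open>P k\<close> the Newton polynomials
  (continued by \<open>a l = 0\<close>, so that \<open>P (m + i) = x\<^sup>i P m\<close>), the rows \<open>P k * q\<close> for \<open>k < m\<close> arise from
  the rows \<open>x\<^sup>k q\<close> by a unitriangular matrix \<open>A\<close>, and from the \<open>P l\<close> by a triangular matrix \<open>B\<close>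
  with diagonal entries \<open>q (a k)\<close>.\<close>
lemma resultant_sub_newton_poly:
  fixes q :: "'a :: comm_ring_1 poly"
  assumes q: "degree q \<le> n" and a: "\<And>l. l \<ge> m \<Longrightarrow> a l = 0"
  shows "resultant_sub m n (newton_poly a m) q = (\<Prod>l<m. poly q (a l))"
proof -
  define N where "N = m + n"
  define P where "P = newton_poly a"
  note deg = degree_monic_newton_poly[of a, folded P_def]
  have shift: "P (m + i) = monom 1 i * P m" for i
    by (induction i) (auto simp: P_def newton_poly_Suc a monom_Suc)
  \<comment> \<open>\<open>s\<close> lists the Sylvester rows from the bottom up: first the
    multiples of \<open>q\<close>, then, by \<open>shift\<close>, the multiples of
    \<open>P m\<close>. In \<open>u\<close> the factor \<open>x ^ l\<close> in front of
    \<open>q\<close> is replaced by \<open>P l\<close>.\<close>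
  define s where "s l = (if l < m then monom 1 l * q else P l)" for l
  define u where "u l = (if l < m then P l * q else P l)" for l
  have S: "sylvester_mat_sub m n (P m) q = coeff_mat N s"
  proof (rule eq_matI; simp add: N_def coeff_mat_def)
    fix i j assume ij: "i < m + n" "j < m + n"
    show "sylvester_mat_sub m n (P m) q $$ (i, j) = coeff (s (m + n - Suc i)) (m + n - Suc j)"
    proof (cases "i < n")
      case True
      have "s (m + n - Suc i) = monom 1 (n - Suc i) * P m"
        using True by (auto simp: s_def shift[symmetric])
      thus ?thesis
        using ij True deg[of m]
        by (auto simp: sylvester_mat_sub_index coeff_monom_mult intro!: coeff_eq_0 arg_cong[of _ _ "coeff (P m)"])
    next
      case False
      have "s (m + n - Suc i) = monom 1 (m + n - Suc i) * q"
        using False ij by (auto simp: s_def)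
      thus ?thesis
        using ij False q
        by (auto simp: sylvester_mat_sub_index coeff_monom_mult intro!: coeff_eq_0 arg_cong[of _ _ "coeff q"])
    qed
  qed
  define \<alpha> where "\<alpha> i l = (if i < m then coeff (P i) l else if l = i then 1 else 0)" for i l
  define A where "A = mat N N (\<lambda>(i, j). \<alpha> (N - 1 - i) (N - 1 - j))"
  have us: "u i = (\<Sum>l<N. smult (\<alpha> i l) (s l))" if i: "i < N" for i
  proof (cases "i < m")
    case True
    have "P i = (\<Sum>l\<le>i. monom (coeff (P i) l) l)"
      using deg[of i] by (metis poly_as_sum_of_monoms')
    also have "\<dots> = (\<Sum>l<m. monom (coeff (P i) l) l)"
      using True deg[of i] by (intro sum.mono_neutral_left) (auto intro!: coeff_eq_0)
    finally have "u i = (\<Sum>l<m. monom (coeff (P i) l) l) * q"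
      using True by (simp add: u_def)
    also have "\<dots> = (\<Sum>l<m. smult (\<alpha> i l) (s l))"
      using True by (simp add: sum_distrib_right s_def \<alpha>_def smult_monom_mult)
    also have "\<dots> = (\<Sum>l<N. smult (\<alpha> i l) (s l))"
      using True deg[of i] by (intro sum.mono_neutral_left) (auto simp: N_def \<alpha>_def coeff_eq_0)
    finally show ?thesis .
  next
    case False
    have "(\<Sum>l<N. smult (\<alpha> i l) (s l)) = (\<Sum>l<N. if l = i then s l else 0)"
      using False by (intro sum.cong) (auto simp: \<alpha>_def)
    also have "\<dots> = u i" using False i by (simp add: s_def u_def)
    finally show ?thesis by simp
  qed
  have "\<exists>b. P i * q = (\<Sum>l<N. smult (b l) (P l)) \<and> b i = poly q (a i) \<and> (\<forall>l<i. b l = 0)" if "i < m" for i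
  proof -
    obtain c where c: "P i * q = (\<Sum>l\<in>{i..i+n}. smult (c l) (P l))" "c i = poly q (a i)"
      using newton_poly_mult_expansion[OF q, of a i] by (auto simp: P_def)
    define b where "b l = (if l \<in> {i..i+n} then c l else 0)" for l
    have "P i * q = (\<Sum>l<N. smult (b l) (P l))"
      unfolding c using that by (intro sum.mono_neutral_cong_left) (auto simp: b_def N_def)
    thus ?thesis using c(2) by (intro exI[of _ b]) (auto simp: b_def)
  qed
  then obtain b where b: "\<And>i. i < m \<Longrightarrow> P i * q = (\<Sum>l<N. smult (b i l) (P l))"
    "\<And>i. i < m \<Longrightarrow> b i i = poly q (a i)" "\<And>i l. i < m \<Longrightarrow> l < i \<Longrightarrow> b i l = 0"
    by metis
  define \<beta> where "\<beta> i l = (if i < m then b i l else if l = i then 1 else 0)" for i l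
  define B where "B = mat N N (\<lambda>(i, j). \<beta> (N - 1 - i) (N - 1 - j))"
  have uP: "u i = (\<Sum>l<N. smult (\<beta> i l) (P l))" if i: "i < N" for i
  proof (cases "i < m")
    case True
    thus ?thesis by (simp add: u_def \<beta>_def b)
  next
    case False
    have "(\<Sum>l<N. smult (\<beta> i l) (P l)) = (\<Sum>l<N. if l = i then P l else 0)"
      using False by (intro sum.cong) (auto simp: \<beta>_def)
    also have "\<dots> = u i" using False i by (simp add: u_def)
    finally show ?thesis by simp
  qed
  have carrier: "A \<in> carrier_mat N N" "B \<in> carrier_mat N N"
    "coeff_mat N F \<in> carrier_mat N N" for F :: "nat \<Rightarrow> 'a poly"
    by (auto simp: A_def B_def coeff_mat_def)
  \<comment> \<open>As the indices run downwards, vanishing for \<open>l > i\<close> makes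
    \<open>A\<close> and \<open>coeff_mat N P\<close> upper triangular, and vanishing for
    \<open>l < i\<close> makes \<open>B\<close> lower triangular.\<close>
  have "det A = (\<Prod>i<N. A $$ (i, i))"
    using carrier deg
    by (subst det_upper_triangular[of _ N])
      (auto simp: prod_list_diag_prod A_def \<alpha>_def atLeast0LessThan intro!: upper_triangularI coeff_eq_0 le_less_trans[OF conjunct1[OF deg]])
  also have "\<dots> = 1"
    using deg by (intro prod.neutral) (auto simp: A_def \<alpha>_def)
  finally have detA: "det A = 1" .
  have "det (coeff_mat N P) = (\<Prod>i<N. coeff_mat N P $$ (i, i))"
    using carrier deg
    by (subst det_upper_triangular[of _ N])
      (auto simp: prod_list_diag_prod coeff_mat_def atLeast0LessThan intro!: upper_triangularI coeff_eq_0 le_less_trans[OF conjunct1[OF deg]])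
  also have "\<dots> = 1"
    using deg by (intro prod.neutral) (auto simp: coeff_mat_def)
  finally have detP: "det (coeff_mat N P) = 1" .
  have "det B = (\<Prod>i<N. B $$ (i, i))"
    using carrier
    by (subst det_lower_triangular[of N])
      (auto simp: prod_list_diag_prod B_def \<beta>_def atLeast0LessThan b)
  also have "\<dots> = (\<Prod>i<N. \<beta> (N - Suc i) (N - Suc i))"
    by (simp add: B_def)
  also have "\<dots> = (\<Prod>i<N. \<beta> i i)"
    by (rule prod.nat_diff_reindex)
  also have "\<dots> = (\<Prod>i<m. \<beta> i i)"
    by (intro prod.mono_neutral_right) (auto simp: N_def \<beta>_def)
  finally have detB: "det B = (\<Prod>l<m. poly q (a l))"
    by (simp add: \<beta>_def b)
  \<comment> \<open>Both products equal \<open>coeff_mat N u\<close>. Of the three triangular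
    determinants only \<open>det B\<close> can differ from 1.\<close>
  have "A * coeff_mat N s = B * coeff_mat N P"
    using coeff_mat_mult[of N u \<alpha> s, OF us] coeff_mat_mult[of N u \<beta> P, OF uP]
    by (simp add: A_def B_def)
  hence "det A * det (coeff_mat N s) = det B * det (coeff_mat N P)"
    by (simp add: det_mult[OF carrier(1,3), symmetric] det_mult[OF carrier(2,3), symmetric])
  thus ?thesis
    using detA detB detP S by (simp add: resultant_sub_def P_def)
qed

text \<open>The homomorphism may lower the degree of \<open>q\<close>, so the Sylvester matrix keeps
  the format given by the original degrees; in that format it commutes with \<open>hom\<close> entry
  by entry. The size of \<open>J\<close> ensures that the degree of \<open>p\<close> does not
  drop.\<close>

lemma (in comm_ring_hom) hom_resultant_eq_prod:
  assumes J: "finite J" "card J = degree p" and p: "map_poly hom p = (\<Prod>j\<in>J. [:- r j, 1:])"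
  shows "hom (resultant p q) = (\<Prod>j\<in>J. poly (map_poly hom q) (r j))"
proof -
  let ?m = "degree p"
  obtain e where e: "bij_betw e {..<?m} J"
    using ex_bij_betw_nat_finite[OF J(1)] J(2) by (auto simp: atLeast0LessThan)
  \<comment> \<open>The continuation by 0 is the one that \<open>resultant_sub_newton_poly\<close>
    assumes.\<close>
  define a where "a l = (if l < ?m then r (e l) else 0)" for l
  have "map_poly hom p = (\<Prod>l<?m. [:- r (e l), 1:])"
    unfolding p by (rule prod.reindex_bij_betw[OF e, symmetric])
  hence P: "map_poly hom p = newton_poly a ?m"
    by (simp add: newton_poly_def a_def)
  have "hom (resultant p q) = resultant_sub ?m (degree q) (map_poly hom p) (map_poly hom q)"
    by (simp add: resultant_sub resultant_sub_def sylvester_mat_sub_map[symmetric])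
  also have "\<dots> = (\<Prod>l<?m. poly (map_poly hom q) (a l))"
    unfolding P by (rule resultant_sub_newton_poly) (auto simp: a_def degree_map_poly_le)
  also have "\<dots> = (\<Prod>l<?m. poly (map_poly hom q) (r (e l)))"
    by (simp add: a_def)
  also have "\<dots> = (\<Prod>j\<in>J. poly (map_poly hom q) (r j))"
    by (rule prod.reindex_bij_betw[OF e])
  finally show ?thesis .
qed

section \<open>Evaluation of multivariate polynomials\<close>

definition mono_eval :: "(nat \<Rightarrow> complex) \<Rightarrow> (nat \<Rightarrow>\<^sub>0 nat) \<Rightarrow> complex" where
  "mono_eval v m = (\<Prod>i\<in>Poly_Mapping.keys m. v i ^ Poly_Mapping.lookup m i)"

lemma mono_eval_superset:
  assumes "finite S" "Poly_Mapping.keys m \<subseteq> S"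
  shows "mono_eval v m = (\<Prod>i\<in>S. v i ^ Poly_Mapping.lookup m i)"
  unfolding mono_eval_def
  using assms by (intro prod.mono_neutral_left) (auto simp: in_keys_iff)

lemma mono_eval_0: "mono_eval v 0 = 1"
  by (simp add: mono_eval_def)

lemma mono_eval_add: "mono_eval v (m + m') = mono_eval v m * mono_eval v m'"
proof -
  let ?S = "Poly_Mapping.keys m \<union> Poly_Mapping.keys m'"
  have "Poly_Mapping.keys (m + m') \<subseteq> ?S" by (rule Poly_Mapping.keys_add)
  thus ?thesis
    by (simp add: mono_eval_superset[of ?S] lookup_add power_add prod.distrib)
qed

lemma meval_superset:
  assumes "finite S" "Poly_Mapping.keys p \<subseteq> S"
  shows "meval v p = (\<Sum>m\<in>S. of_rat (Poly_Mapping.lookup p m) * mono_eval v m)"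
  unfolding meval_def mono_eval_def[symmetric]
  using assms by (intro sum.mono_neutral_left) (auto simp: in_keys_iff)

lemma meval_add: "meval v (p + q) = meval v p + meval v q"
proof -
  let ?S = "Poly_Mapping.keys p \<union> Poly_Mapping.keys q"
  have "Poly_Mapping.keys (p + q) \<subseteq> ?S" by (rule Poly_Mapping.keys_add)
  thus ?thesis
    by (simp add: meval_superset[of ?S] lookup_add of_rat_add algebra_simps sum.distrib)
qed

lemma meval_0: "meval v 0 = 0"
  by (simp add: meval_def)

lemma meval_sum: "meval v (sum f A) = (\<Sum>x\<in>A. meval v (f x))"
  by (induction A rule: infinite_finite_induct) (auto simp: meval_0 meval_add)

lemma meval_single: "meval v (Poly_Mapping.single m c) = of_rat c * mono_eval v m"
  by (subst meval_superset[of "{m}"]) auto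

lemma sum_single_lookup:
  "p = (\<Sum>m\<in>Poly_Mapping.keys p. Poly_Mapping.single m (Poly_Mapping.lookup p m))"
  by (rule poly_mapping_eqI)
    (auto simp: lookup_sum lookup_single when_def in_keys_iff)

lemma meval_mult: "meval v (p * q) = meval v p * meval v q"
proof -
  have "p * q = (\<Sum>m\<in>Poly_Mapping.keys p. \<Sum>m'\<in>Poly_Mapping.keys q.
      Poly_Mapping.single (m + m') (Poly_Mapping.lookup p m * Poly_Mapping.lookup q m'))"
    by (subst (1) sum_single_lookup[of p], subst (1) sum_single_lookup[of q])
      (simp add: sum_product mult_single)
  hence "meval v (p * q) = (\<Sum>m\<in>Poly_Mapping.keys p. \<Sum>m'\<in>Poly_Mapping.keys q.
      of_rat (Poly_Mapping.lookup p m * Poly_Mapping.lookup q m') * mono_eval v (m + m'))"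
    by (simp add: meval_sum meval_single)
  also have "\<dots> = meval v p * meval v q"
    unfolding meval_def mono_eval_def[symmetric] sum_product
    by (simp add: of_rat_mult mono_eval_add mult_ac)
  finally show ?thesis .
qed

lemma meval_Const: "meval v (Const c) = of_rat c"
  by (simp add: Const_def meval_single mono_eval_0)

lemma meval_Var: "meval v (Var i) = v i"
  by (simp add: Var_def meval_single mono_eval_def)

lemma meval_1: "meval v 1 = 1"
  by (metis meval_single mono_eval_0 mult_1 of_rat_1 single_one)

interpretation meval: comm_ring_hom "meval v" for v
  by unfold_locales (auto simp: meval_0 meval_add meval_1 meval_mult)

text \<open>Uniqueness of base-\<open>b\<close> digits: reduction modulo \<open>b\<close> isolates
  the lowest digit, and the remaining ones follow by induction. It makes the exponents of the
  Kronecker substitution distinct.\<close>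

lemma digit_sum_inj:
  fixes x y :: "nat \<Rightarrow> nat"
  assumes "\<And>i. i < N \<Longrightarrow> x i < b" "\<And>i. i < N \<Longrightarrow> y i < b"
    and "(\<Sum>i<N. x i * b ^ i) = (\<Sum>i<N. y i * b ^ i)" and "i < N"
  shows "x i = y i"
  using assms
proof (induction N arbitrary: x y i)
  case (Suc N)
  have split: "(\<Sum>i<Suc N. z i * b ^ i) = z 0 + b * (\<Sum>i<N. z (Suc i) * b ^ i)" for z
    unfolding sum.lessThan_Suc_shift by (simp add: sum_distrib_left mult_ac)
  have eq: "x 0 + b * (\<Sum>i<N. x (Suc i) * b ^ i) = y 0 + b * (\<Sum>i<N. y (Suc i) * b ^ i)"
    using Suc.prems(3) by (simp only: split)
  have lt: "x 0 < b" "y 0 < b" using Suc.prems by auto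
  have "x 0 = (x 0 + b * (\<Sum>i<N. x (Suc i) * b ^ i)) mod b" using lt by simp
  also have "\<dots> = y 0" unfolding eq using lt by simp
  finally have 0: "x 0 = y 0" .
  with eq lt have "(\<Sum>i<N. x (Suc i) * b ^ i) = (\<Sum>i<N. y (Suc i) * b ^ i)" by auto
  hence *: "x (Suc j) = y (Suc j)" if "j < N" for j
    using Suc.prems(1,2) that by (intro Suc.IH[of "\<lambda>i. x (Suc i)" "\<lambda>i. y (Suc i)"]) auto
  show ?case
  proof (cases i)
    case (Suc j)
    thus ?thesis using *[of j] \<open>i < Suc N\<close> by simp
  qed (simp add: 0)
qed simp

text \<open>Kronecker substitution: the point \<open>v i = t ^ (b ^ i)\<close>, with \<open>b\<close> exceeding every
  exponent, sends distinct monomials of \<open>p\<close> to distinct powers of \<open>t\<close>.\<close>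
lemma meval_eq_0_imp_eq_0:
  assumes zero: "\<And>v. meval v p = 0"
  shows "p = 0"
proof -
  define K where "K = Poly_Mapping.keys p"
  have finK: "finite K" by (simp add: K_def)
  define V where "V = (\<Union>m\<in>K. Poly_Mapping.keys m)"
  have finV: "finite V" by (simp add: V_def K_def)
  then obtain N where N: "V \<subseteq> {..<N}" by (auto dest: finite_nat_iff_bounded[THEN iffD1])
  define L where "L = (\<Union>m\<in>K. Poly_Mapping.lookup m ` V)"
  have "finite L" using finK finV by (simp add: L_def)
  then obtain b where b: "L \<subseteq> {..<b}" by (auto dest: finite_nat_iff_bounded[THEN iffD1])
  have keys: "Poly_Mapping.keys m \<subseteq> {..<N}" if "m \<in> K" for m
    using that N by (auto simp: V_def)
  \<comment> \<open>The base is \<open>Suc b\<close>, so that the exponent 0 of a variable outside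
    \<open>V\<close> is a valid digit even if \<open>b = 0\<close>.\<close>
  have bound: "Poly_Mapping.lookup m i < Suc b" if "m \<in> K" for m i
  proof (cases "i \<in> V")
    case True
    thus ?thesis using that b by (force simp: L_def)
  next
    case False
    hence "Poly_Mapping.lookup m i = 0" using that by (auto simp: V_def in_keys_iff)
    thus ?thesis by simp
  qed
  define e where "e m = (\<Sum>i<N. Poly_Mapping.lookup m i * Suc b ^ i)" for m
  have inj: "inj_on e K"
  proof (rule inj_onI)
    fix m m' assume m: "m \<in> K" "m' \<in> K" and eq: "e m = e m'"
    show "m = m'"
    proof (rule poly_mapping_eqI)
      fix i
      show "Poly_Mapping.lookup m i = Poly_Mapping.lookup m' i"
      proof (cases "i < N")
        case True
        show ?thesis
          by (rule digit_sum_inj[OF _ _ eq[unfolded e_def] True]) (use bound m in auto)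
      next
        case False
        hence "i \<notin> Poly_Mapping.keys m" "i \<notin> Poly_Mapping.keys m'"
          using keys[OF m(1)] keys[OF m(2)] by auto
        thus ?thesis by (simp add: in_keys_iff)
      qed
    qed
  qed
  define g :: "complex poly" where
    "g = (\<Sum>m\<in>K. monom (of_rat (Poly_Mapping.lookup p m)) (e m))"
  have "poly g t = 0" for t
  proof -
    have "mono_eval (\<lambda>i. t ^ (Suc b ^ i)) m = t ^ e m" if "m \<in> K" for m
      using keys[OF that]
      by (subst mono_eval_superset[of "{..<N}"])
        (auto simp: e_def power_sum power_mult[symmetric] mult_ac)
    hence "poly g t = meval (\<lambda>i. t ^ (Suc b ^ i)) p"
      by (simp add: g_def poly_sum poly_monom meval_def mono_eval_def[symmetric] K_def)
    thus ?thesis using zero by simp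
  qed
  hence g0: "g = 0" using poly_all_0_iff_0 by blast
  have "Poly_Mapping.lookup p m = 0" if "m \<in> K" for m
  proof -
    have "coeff g (e m) = (\<Sum>m'\<in>K. if m' = m then of_rat (Poly_Mapping.lookup p m') else 0)"
      unfolding g_def coeff_sum using inj that
      by (intro sum.cong) (auto simp: inj_on_def)
    thus ?thesis using g0 finK that by simp
  qed
  thus ?thesis
    by (intro poly_mapping_eqI) (auto simp: K_def in_keys_iff)
qed

text \<open>This allows an arbitrary point to be replaced by the coefficient sequence of a monic
  polynomial, with which it agrees only below \<open>n\<close>.\<close>

lemma meval_cong_mvars:
  assumes "\<And>i. i \<in> mvars p \<Longrightarrow> v i = w i"
  shows "meval v p = meval w p"
proof -
  have "v i = w i" if "m \<in> Poly_Mapping.keys p" "i \<in> Poly_Mapping.keys m" for m i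
    using assms that by (auto simp: mvars_def)
  thus ?thesis unfolding meval_def by simp
qed

lemma mvars_add: "mvars (p + q) \<subseteq> mvars p \<union> mvars q"
  using Poly_Mapping.keys_add[of p q] by (auto simp: mvars_def)

lemma mvars_mult: "mvars (p * q) \<subseteq> mvars p \<union> mvars q"
proof
  fix i assume "i \<in> mvars (p * q)"
  then obtain m where m: "m \<in> Poly_Mapping.keys (p * q)" "i \<in> Poly_Mapping.keys m"
    by (auto simp: mvars_def)
  then obtain a b where "m = a + b" "a \<in> Poly_Mapping.keys p" "b \<in> Poly_Mapping.keys q"
    using Poly_Mapping.keys_mult[of p q] by auto
  thus "i \<in> mvars p \<union> mvars q"
    using m(2) Poly_Mapping.keys_add[of a b] by (auto simp: mvars_def)
qed

lemma mvars_Const: "mvars (Const c) = {}"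
  by (auto simp: mvars_def Const_def split: if_splits)

lemma mvars_Var: "mvars (Var i) = {i}"
  by (auto simp: mvars_def Var_def)

section \<open>Symmetric functions of the roots\<close>

text \<open>\<open>F\<close> is a rational polynomial in the lower coefficients of the monic
  polynomial with roots \<open>r\<close>. Functions of the roots take the place of formal
  polynomials, so the theorem on symmetric functions is reached through closure properties of this
  predicate.\<close>

definition sym_rep :: "nat \<Rightarrow> ((nat \<Rightarrow> complex) \<Rightarrow> complex) \<Rightarrow> bool" where
  "sym_rep n F \<longleftrightarrow> (\<exists>D. mvars D \<subseteq> {..<n} \<and>
     (\<forall>r. meval (\<lambda>i. coeff (\<Prod>j<n. [:- r j, 1:]) i) D = F r))"

lemma sym_rep_const: "sym_rep n (\<lambda>_. of_rat c)"
  unfolding sym_rep_def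
  by (intro exI[of _ "Const c"]) (auto simp: mvars_Const meval_Const)

lemma sym_rep_add: "sym_rep n F \<Longrightarrow> sym_rep n G \<Longrightarrow> sym_rep n (\<lambda>r. F r + G r)"
  unfolding sym_rep_def
proof (elim exE conjE)
  fix D D' assume "mvars D \<subseteq> {..<n}" "mvars D' \<subseteq> {..<n}"
    "\<forall>r. meval (coeff (\<Prod>j<n. [:- r j, 1:])) D = F r"
    "\<forall>r. meval (coeff (\<Prod>j<n. [:- r j, 1:])) D' = G r"
  thus "\<exists>D. mvars D \<subseteq> {..<n} \<and> (\<forall>r. meval (coeff (\<Prod>j<n. [:- r j, 1:])) D = F r + G r)"
    using mvars_add[of D D'] by (intro exI[of _ "D + D'"]) (auto simp: meval_add)
qed

lemma sym_rep_mult: "sym_rep n F \<Longrightarrow> sym_rep n G \<Longrightarrow> sym_rep n (\<lambda>r. F r * G r)"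
  unfolding sym_rep_def
proof (elim exE conjE)
  fix D D' assume "mvars D \<subseteq> {..<n}" "mvars D' \<subseteq> {..<n}"
    "\<forall>r. meval (coeff (\<Prod>j<n. [:- r j, 1:])) D = F r"
    "\<forall>r. meval (coeff (\<Prod>j<n. [:- r j, 1:])) D' = G r"
  thus "\<exists>D. mvars D \<subseteq> {..<n} \<and> (\<forall>r. meval (coeff (\<Prod>j<n. [:- r j, 1:])) D = F r * G r)"
    using mvars_mult[of D D'] by (intro exI[of _ "D * D'"]) (auto simp: meval_mult)
qed

lemma sym_rep_scale: "sym_rep n F \<Longrightarrow> sym_rep n (\<lambda>r. of_rat c * F r)"
  by (intro sym_rep_mult sym_rep_const)

lemma sym_rep_diff:
  assumes "sym_rep n F" "sym_rep n G" 
  shows "sym_rep n (\<lambda>r. F r - G r)"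
  using sym_rep_add[OF assms(1) sym_rep_scale[OF assms(2), of "-1"]] by simp

lemma sym_rep_sum:
  assumes "\<And>x. x \<in> A \<Longrightarrow> sym_rep n (F x)"
  shows "sym_rep n (\<lambda>r. \<Sum>x\<in>A. F x r)"
  using assms
proof (induction A rule: infinite_finite_induct)
  case (insert x A)
  thus ?case by (simp add: sym_rep_add)
qed (use sym_rep_const[of n 0] in simp_all)

lemma degree_monic_prod_linear:
  fixes r :: "'b \<Rightarrow> 'a :: idom"
  shows "degree (\<Prod>j\<in>A. [:- r j, 1:]) = card A" "lead_coeff (\<Prod>j\<in>A. [:- r j, 1:]) = 1"
  by (simp add: degree_prod_eq_sum_degree) (simp only: lead_coeff_prod, simp)

lemma sym_rep_coeff: "sym_rep n (\<lambda>r. coeff (\<Prod>j<n. [:- r j, 1:]) i)"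
proof -
  consider "i < n" | "i = n" | "i > n" by linarith
  thus ?thesis
  proof cases
    case 1
    thus ?thesis unfolding sym_rep_def
      by (intro exI[of _ "Var i"]) (auto simp: mvars_Var meval_Var)
  next
    case 2
    have "coeff (\<Prod>j<n. [:- r j, 1:]) n = 1" for r :: "nat \<Rightarrow> complex"
      using degree_monic_prod_linear[of r "{..<n}"] by simp
    thus ?thesis using 2 sym_rep_const[of n 1] by simp
  next
    case 3
    have "coeff (\<Prod>j<n. [:- r j, 1:]) i = 0" for r :: "nat \<Rightarrow> complex"
      using degree_monic_prod_linear(1)[of r "{..<n}"] 3 by (intro coeff_eq_0) simp
    thus ?thesis using sym_rep_const[of n 0] by simp
  qed
qed

section \<open>Newton's identities for power sums\<close>

lemma reflect_prod_linear:
  fixes r :: "nat \<Rightarrow> complex"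
  shows "reflect_poly (\<Prod>j<n. [:- r j, 1:]) = (\<Prod>j<n. [:1, - r j:])"
proof -
  have "reflect_poly [:- x, 1:] = [:1, - x:]" for x :: complex
    by (cases "x = 0") (auto simp: reflect_poly_def)
  thus ?thesis by (simp add: reflect_poly_prod)
qed

lemma sym_rep_reflected_coeff: "sym_rep n (\<lambda>r. coeff (\<Prod>j<n. [:1, - r j:]) k)"
proof (cases "k > n")
  case True
  hence "coeff (\<Prod>j<n. [:1, - r j:]) k = 0" for r :: "nat \<Rightarrow> complex"
    using degree_monic_prod_linear(1)[of r "{..<n}"]
    by (simp add: reflect_prod_linear[symmetric] coeff_reflect_poly)
  thus ?thesis using sym_rep_const[of n 0] by simp
next
  case False
  hence "coeff (\<Prod>j<n. [:1, - r j:]) k = coeff (\<Prod>j<n. [:- r j, 1:]) (n - k)"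
    for r :: "nat \<Rightarrow> complex"
    using degree_monic_prod_linear(1)[of r "{..<n}"]
    by (simp add: reflect_prod_linear[symmetric] coeff_reflect_poly)
  thus ?thesis by (simp add: sym_rep_coeff)
qed

text \<open>The logarithmic derivative of the product of the \<open>1 - r j * x\<close> is the sum
  of the \<open>- r j / (1 - r j * x)\<close>, the generating function of the negated power sums.
  Multiplying by the product avoids division.\<close>

lemma logarithmic_derivative_fps:
  fixes r :: "nat \<Rightarrow> complex"
  shows "fps_deriv (fps_of_poly (\<Prod>j<n. [:1, - r j:])) =
    - fps_of_poly (\<Prod>j<n. [:1, - r j:]) * Abs_fps (\<lambda>m. \<Sum>j<n. r j ^ Suc m)"
proof (induction n)
  case 0
  have "Abs_fps (\<lambda>m. 0 :: complex) = 0" by (simp add: fps_eq_iff)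
  thus ?case by simp
next
  case (Suc n)
  define g where "g = fps_of_poly (\<Prod>j<n. [:1, - r j:])"
  define A where "A = Abs_fps (\<lambda>m. \<Sum>j<n. r j ^ Suc m)"
  \<comment> \<open>The geometric series of \<open>r n / (1 - r n * x)\<close>, contributed by the
    new factor.\<close>
  define S where "S = Abs_fps (\<lambda>m. r n ^ Suc m)"
  define L where "L = fps_of_poly [:1, - r n:]"
  have L: "L = 1 - fps_const (r n) * fps_X"
    by (simp add: L_def fps_of_poly_pCons)
  have LS: "L * S = fps_const (r n)"
  proof (rule fps_ext)
    fix k
    show "fps_nth (L * S) k = fps_nth (fps_const (r n)) k"
      by (cases k) (simp_all add: L S_def algebra_simps mult.assoc)
  qed
  have dL: "fps_deriv L = - fps_const (r n)"
    by (simp add: L)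
  have AS: "Abs_fps (\<lambda>m. \<Sum>j<Suc n. r j ^ Suc m) = A + S"
    by (simp add: A_def S_def fps_eq_iff)
  have gL: "fps_of_poly (\<Prod>j<Suc n. [:1, - r j:]) = g * L"
    by (simp add: g_def L_def fps_of_poly_mult mult.commute)
  have IH: "fps_deriv g = - g * A"
    using Suc.IH unfolding g_def A_def .
  have "fps_deriv (g * L) = g * - (L * S) + - g * A * L"
    by (simp only: fps_deriv_mult dL LS IH)
  also have "\<dots> = - (g * L) * (A + S)" by (simp add: algebra_simps)
  finally show ?case unfolding gL AS .
qed

text \<open>Comparison of the coefficients of \<open>x ^ k\<close> in the logarithmic derivative,
  solved for the highest power sum, whose coefficient is \<open>g 0 = 1\<close>. The cases
  \<open>k < n\<close> and \<open>k \<ge> n\<close> coincide because \<open>g\<close> vanishes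
  beyond \<open>n\<close>.\<close>

lemma newton_identity:
  fixes r :: "nat \<Rightarrow> complex" and n k :: nat
  defines "g \<equiv> \<lambda>k. coeff (\<Prod>j<n. [:1, - r j:]) k"
  shows "(\<Sum>j<n. r j ^ Suc k) =
    - of_nat (Suc k) * g (Suc k) - (\<Sum>i<k. g (Suc i) * (\<Sum>j<n. r j ^ (k - i)))"
proof -
  have g0: "g 0 = 1"
    by (simp add: g_def flip: poly_0_coeff_0 add: poly_prod)
  have "of_nat (Suc k) * g (Suc k) = fps_nth (fps_deriv (fps_of_poly (\<Prod>j<n. [:1, - r j:]))) k"
    by (simp add: g_def)
  also have "\<dots> = - (\<Sum>i\<le>k. g i * (\<Sum>j<n. r j ^ Suc (k - i)))"
    unfolding logarithmic_derivative_fps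
    by (simp add: fps_mult_nth g_def sum_negf atMost_atLeast0)
  also have "(\<Sum>i\<le>k. g i * (\<Sum>j<n. r j ^ Suc (k - i))) =
      (\<Sum>j<n. r j ^ Suc k) + (\<Sum>i<k. g (Suc i) * (\<Sum>j<n. r j ^ (k - i)))"
    unfolding sum.atMost_shift by (simp add: g0 Suc_diff_Suc del: power_Suc)
  finally show ?thesis by (simp del: power_Suc of_nat_Suc)
qed

text \<open>Strong induction: Newton's identity leaves only coefficients and power sums with smaller
  exponents. Exponent 0 gives the constant \<open>n\<close>.\<close>

lemma sym_rep_power_sum: "sym_rep n (\<lambda>r. \<Sum>j<n. r j ^ m)"
proof (induction m rule: less_induct)
  case (less m)
  show ?case
  proof (cases m)
    case 0
    thus ?thesis using sym_rep_const[of n "of_nat n"] by simp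
  next
    case (Suc k)
    have "sym_rep n (\<lambda>r. of_rat (- of_nat (Suc k)) * coeff (\<Prod>j<n. [:1, - r j:]) (Suc k) -
        (\<Sum>i<k. coeff (\<Prod>j<n. [:1, - r j:]) (Suc i) * (\<Sum>j<n. r j ^ (k - i))))"
      by (intro sym_rep_diff sym_rep_scale sym_rep_reflected_coeff
          sym_rep_sum[where A = "{..<k}"] sym_rep_mult less) (simp add: Suc)
    thus ?thesis
      unfolding Suc newton_identity by (simp add: of_rat_minus del: of_nat_Suc)
  qed
qed

section \<open>Symmetrisation over injections\<close>

definition injections :: "'a set \<Rightarrow> 'b set \<Rightarrow> ('a \<Rightarrow> 'b) set" where
  "injections A B = {\<phi> \<in> A \<rightarrow>\<^sub>E B. inj_on \<phi> A}"

lemma finite_injections: "finite A \<Longrightarrow> finite B \<Longrightarrow> finite (injections A B)"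
  by (auto simp: injections_def finite_PiE)

text \<open>Restriction to \<open>A\<close> fibres the injections of \<open>insert x A\<close>; the
  value at \<open>x\<close> is free outside the image of \<open>A\<close>. As the functions are
  extensional, restriction is the update of \<open>x\<close> to \<open>undefined\<close>.\<close>

lemma sum_injections_insert:
  assumes "x \<notin> A"
  shows "(\<Sum>\<phi>\<in>injections (insert x A) B. F \<phi>) =
    (\<Sum>(\<phi>, y)\<in>(SIGMA \<phi>:injections A B. B - \<phi> ` A). F (\<phi>(x := y)))"
proof (rule sum.reindex_bij_witness[where i = "\<lambda>(\<phi>, y). \<phi>(x := y)" and
    j = "\<lambda>\<phi>. (\<phi>(x := undefined), \<phi> x)"])
  fix \<phi> assume \<phi>: "\<phi> \<in> injections (insert x A) B"
  hence "\<phi>(x := undefined) \<in> A \<rightarrow>\<^sub>E B"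
    using assms by (auto simp: injections_def PiE_iff extensional_def)
  moreover have "inj_on (\<phi>(x := undefined)) A"
    using \<phi> assms by (auto simp: injections_def inj_on_def)
  moreover have "\<phi> x \<in> B - \<phi>(x := undefined) ` A"
    using \<phi> assms by (auto simp: injections_def inj_on_def)
  ultimately show "(\<phi>(x := undefined), \<phi> x) \<in> (SIGMA \<phi>:injections A B. B - \<phi> ` A)"
    by (auto simp: injections_def)
next
  fix z assume "z \<in> (SIGMA \<phi>:injections A B. B - \<phi> ` A)"
  then obtain \<phi> y where z: "z = (\<phi>, y)" "\<phi> \<in> A \<rightarrow>\<^sub>E B" "inj_on \<phi> A" "y \<in> B" "y \<notin> \<phi> ` A"
    by (auto simp: injections_def)
  have "\<phi> x = undefined" using z assms by auto
  thus "(\<lambda>\<phi>. (\<phi>(x := undefined), \<phi> x)) (case z of (\<phi>, y) \<Rightarrow> \<phi>(x := y)) = z"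
    using z by auto
  have "\<phi>(x := y) \<in> insert x A \<rightarrow>\<^sub>E B" using z by (auto simp: PiE_iff extensional_def)
  moreover have "inj_on (\<phi>(x := y)) (insert x A)"
    using z assms by (auto simp: inj_on_def)
  ultimately show "(case z of (\<phi>, y) \<Rightarrow> \<phi>(x := y)) \<in> injections (insert x A) B"
    using z by (simp add: injections_def)
qed auto

text \<open>The last argument of an injection ranges over the complement of the image of the others:
  the full range yields a power sum, and each excluded value merges two exponents.\<close>
lemma sym_rep_sum_injections:
  fixes A :: "'a set"
  assumes "finite A"
  shows "sym_rep n (\<lambda>r. \<Sum>\<phi>\<in>injections A {..<n}. \<Prod>i\<in>A. r (\<phi> i) ^ a i)"
  using assms
proof (induction A arbitrary: a)
  case empty
  have "injections ({} :: 'a set) {..<n} = {\<lambda>_. undefined}" by (auto simp: injections_def)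
  thus ?case using sym_rep_const[of n 1] by simp
next
  case (insert x A)
  have "(\<Sum>\<phi>\<in>injections (insert x A) {..<n}. \<Prod>i\<in>insert x A. r (\<phi> i) ^ a i) =
      (\<Sum>j<n. r j ^ a x) * (\<Sum>\<phi>\<in>injections A {..<n}. \<Prod>i\<in>A. r (\<phi> i) ^ a i) -
      (\<Sum>z\<in>A. \<Sum>\<phi>\<in>injections A {..<n}. \<Prod>i\<in>A. r (\<phi> i) ^ (a(z := a z + a x)) i)"
    (is "?lhs = ?rhs") for r :: "nat \<Rightarrow> complex"
  proof -
    have upd: "(\<Prod>i\<in>A. r ((\<phi>(x := y)) i) ^ a i) = (\<Prod>i\<in>A. r (\<phi> i) ^ a i)" for \<phi> y
      using insert.hyps(2) by (intro prod.cong) auto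
    have "?lhs = (\<Sum>(\<phi>, y)\<in>(SIGMA \<phi>:injections A {..<n}. {..<n} - \<phi> ` A).
        r y ^ a x * (\<Prod>i\<in>A. r (\<phi> i) ^ a i))"
      unfolding sum_injections_insert[OF insert.hyps(2)]
      using insert.hyps by (simp add: upd del: fun_upd_apply) simp
    also have "\<dots> = (\<Sum>\<phi>\<in>injections A {..<n}. \<Sum>y\<in>{..<n} - \<phi> ` A.
        r y ^ a x * (\<Prod>i\<in>A. r (\<phi> i) ^ a i))"
      using insert.hyps by (subst sum.Sigma) (auto intro: finite_injections)
    also have "\<dots> = (\<Sum>\<phi>\<in>injections A {..<n}. (\<Sum>j<n. r j ^ a x) * (\<Prod>i\<in>A. r (\<phi> i) ^ a i) -
        (\<Sum>z\<in>A. \<Prod>i\<in>A. r (\<phi> i) ^ (a(z := a z + a x)) i))"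
    proof (intro sum.cong refl)
      fix \<phi> assume "\<phi> \<in> injections A {..<n}"
      hence \<phi>: "\<phi> ` A \<subseteq> {..<n}" "inj_on \<phi> A" by (auto simp: injections_def)
      \<comment> \<open>Injectivity turns the sum over the excluded image into a sum over
        \<open>A\<close>.\<close>
      have "(\<Sum>y\<in>{..<n} - \<phi> ` A. r y ^ a x) = (\<Sum>j<n. r j ^ a x) - (\<Sum>z\<in>A. r (\<phi> z) ^ a x)"
        using \<phi> insert.hyps by (subst sum_diff) (auto simp: sum.reindex)
      moreover have "r (\<phi> z) ^ a x * (\<Prod>i\<in>A. r (\<phi> i) ^ a i) =
          (\<Prod>i\<in>A. r (\<phi> i) ^ (a(z := a z + a x)) i)" if "z \<in> A" for z
        using insert.hyps that by (simp add: prod.remove[of A z] power_add mult_ac)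
      ultimately show "(\<Sum>y\<in>{..<n} - \<phi> ` A. r y ^ a x * (\<Prod>i\<in>A. r (\<phi> i) ^ a i)) =
          (\<Sum>j<n. r j ^ a x) * (\<Prod>i\<in>A. r (\<phi> i) ^ a i) -
          (\<Sum>z\<in>A. \<Prod>i\<in>A. r (\<phi> i) ^ (a(z := a z + a x)) i)"
        by (simp add: sum_distrib_right[symmetric] left_diff_distrib) (simp add: sum_distrib_right)
    qed
    also have "\<dots> = ?rhs"
      by (simp add: sum_subtractf sum_distrib_left sum.swap[of _ A])
    finally show ?thesis .
  qed
  thus ?case
    by (simp only:) (intro sym_rep_diff sym_rep_mult sym_rep_power_sum sym_rep_sum insert.IH)
qed

text \<open>The extra monomial absorbs the variables as the linear factors are expanded one by one.\<close>
lemma sym_rep_symmetrized_prod: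
  fixes c :: "'t \<Rightarrow> nat \<Rightarrow> rat"
  assumes "finite S"
  shows "sym_rep n (\<lambda>r. \<Sum>\<phi>\<in>injections {..<n} {..<n}.
    (\<Prod>t\<in>S. \<Sum>i<n. of_rat (c t i) * r (\<phi> i)) * (\<Prod>i<n. r (\<phi> i) ^ a i))"
  using assms
proof (induction S arbitrary: a)
  case empty
  thus ?case by (simp add: sym_rep_sum_injections)
next
  case (insert t S)
  have "(\<Sum>\<phi>\<in>injections {..<n} {..<n}.
      (\<Prod>t\<in>insert t S. \<Sum>i<n. of_rat (c t i) * r (\<phi> i)) * (\<Prod>i<n. r (\<phi> i) ^ a i)) =
    (\<Sum>k<n. of_rat (c t k) * (\<Sum>\<phi>\<in>injections {..<n} {..<n}.
      (\<Prod>t\<in>S. \<Sum>i<n. of_rat (c t i) * r (\<phi> i)) * (\<Prod>i<n. r (\<phi> i) ^ (a(k := a k + 1)) i)))"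
    (is "?lhs = ?rhs") for r :: "nat \<Rightarrow> complex"
  proof -
    have bump: "r (\<phi> k) * (\<Prod>i<n. r (\<phi> i) ^ a i) = (\<Prod>i<n. r (\<phi> i) ^ (a(k := a k + 1)) i)"
      if "k < n" for k and \<phi> :: "nat \<Rightarrow> nat"
      using that by (simp add: prod.remove[of "{..<n}" k] mult_ac)
    have "?lhs = (\<Sum>\<phi>\<in>injections {..<n} {..<n}. \<Sum>k<n. of_rat (c t k) *
        ((\<Prod>t\<in>S. \<Sum>i<n. of_rat (c t i) * r (\<phi> i)) * (r (\<phi> k) * (\<Prod>i<n. r (\<phi> i) ^ a i))))"
      using insert.hyps by (simp add: sum_distrib_right mult.assoc) (simp add: mult_ac)
    also have "\<dots> = ?rhs"
      by (subst sum.swap) (simp add: bump sum_distrib_left)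
    finally show ?thesis .
  qed
  thus ?case
    by (simp only:) (intro sym_rep_sum sym_rep_scale insert.IH)
qed

text \<open>The injections of \<open>{..<n}\<close> into itself are its permutations. A symmetric
  \<open>F\<close> equals its average over them, which is the symmetrised product with all exponents
  \<open>a i = 0\<close>, scaled by a rational number.\<close>

lemma sym_rep_symmetric_prod:
  fixes c :: "'t \<Rightarrow> nat \<Rightarrow> rat"
  assumes "finite S" and F: "\<And>r. F r = (\<Prod>t\<in>S. \<Sum>i<n. of_rat (c t i) * r i)"
    and sym: "\<And>r \<phi>. bij_betw \<phi> {..<n} {..<n} \<Longrightarrow> F (r \<circ> \<phi>) = F r"
  shows "sym_rep n F"
proof -
  define N where "N = card (injections {..<n} {..<n})"
  \<comment> \<open>The identity shows that the set is nonempty, so that division by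
    \<open>N\<close> is possible.\<close>
  have "restrict id {..<n} \<in> injections {..<n} {..<n}"
    by (auto simp: injections_def)
  hence N: "N \<noteq> 0"
    unfolding N_def by (subst card_0_eq) (auto simp: finite_injections)
  have bij: "bij_betw \<phi> {..<n} {..<n}" if "\<phi> \<in> injections {..<n} {..<n}" for \<phi>
    using that endo_inj_surj[of "{..<n}" \<phi>] by (auto simp: injections_def bij_betw_def)
  have "F r = of_rat (1 / of_nat N) * (\<Sum>\<phi>\<in>injections {..<n} {..<n}.
    (\<Prod>t\<in>S. \<Sum>i<n. of_rat (c t i) * r (\<phi> i)) * (\<Prod>i<n. r (\<phi> i) ^ 0))" for r
  proof -
    have "(\<Sum>\<phi>\<in>injections {..<n} {..<n}.
        (\<Prod>t\<in>S. \<Sum>i<n. of_rat (c t i) * r (\<phi> i)) * (\<Prod>i<n. r (\<phi> i) ^ 0)) =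
        (\<Sum>\<phi>\<in>injections {..<n} {..<n}. F r)"
    proof (rule sum.cong[OF refl])
      fix \<phi> assume "\<phi> \<in> injections {..<n} {..<n}"
      thus "(\<Prod>t\<in>S. \<Sum>i<n. of_rat (c t i) * r (\<phi> i)) * (\<Prod>i<n. r (\<phi> i) ^ 0) = F r"
        using sym[OF bij, of \<phi> r] F[of "r \<circ> \<phi>"] by simp
    qed
    thus ?thesis using N by (simp add: N_def of_rat_divide)
  qed
  hence "F = (\<lambda>r. of_rat (1 / of_nat N) * (\<Sum>\<phi>\<in>injections {..<n} {..<n}.
    (\<Prod>t\<in>S. \<Sum>i<n. of_rat (c t i) * r (\<phi> i)) * (\<Prod>i<n. r (\<phi> i) ^ 0)))"
    by blast
  thus ?thesis
    by (simp only:) (intro sym_rep_scale sym_rep_symmetrized_prod[OF assms(1)])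
qed

section \<open>The iterated resultant\<close>

lemma coeff_gen_poly: "coeff (gen_poly n) i = (if i < n then Var i else if i = n then 1 else 0)"
  by (auto simp: gen_poly_def coeff_sum)

lemma degree_gen_poly: "degree (gen_poly n) = n"
  by (intro antisym degree_le le_degree) (auto simp: coeff_gen_poly)

lemma map_poly_meval_gen_poly:
  assumes "\<And>i. i < n \<Longrightarrow> v i = coeff (\<Prod>j<n. [:- r j, 1:]) i"
  shows "map_poly (meval v) (gen_poly n) = (\<Prod>j<n. [:- r j, 1:])"
proof (rule poly_eqI)
  fix i
  have "coeff (\<Prod>j<n. [:- r j, 1:]) n = 1"
    using degree_monic_prod_linear[of r "{..<n}"] by simp
  moreover have "coeff (\<Prod>j<n. [:- r j, 1:]) i = 0" if "i > n"
    using degree_monic_prod_linear(1)[of r "{..<n}"] that by (intro coeff_eq_0) simp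
  ultimately show "coeff (map_poly (meval v) (gen_poly n)) i = coeff (\<Prod>j<n. [:- r j, 1:]) i"
    using assms by (auto simp: coeff_gen_poly meval_Var meval_0 meval_1)
qed

text \<open>The fundamental theorem of algebra, with the multiset of roots listed as a sequence, so
  that multiplicities become repeated values.\<close>

lemma monic_complex_poly_splits:
  fixes p :: "complex poly"
  assumes "lead_coeff p = 1"
  obtains r where "p = (\<Prod>j<degree p. [:- r j, 1:])"
proof -
  have "p \<noteq> 0" using assms by auto
  then obtain A where A: "size A = degree p" "p = smult (lead_coeff p) (\<Prod>x\<in>#A. [:- x, 1:])"
    using alg_closed_imp_factorization by blast
  obtain xs where xs: "A = mset xs" by (metis ex_mset)
  have "p = prod_list (map (\<lambda>x. [:- x, 1:]) xs)"
    using A(2) assms by (simp add: xs prod_mset_prod_list flip: mset_map)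
  also have "\<dots> = (\<Prod>j<degree p. [:- xs ! j, 1:])"
    using A(1) by (simp add: xs prod.list_conv_set_nth atLeast0LessThan)
  finally show ?thesis by (rule that)
qed

section \<open>Specialisation of the bivariate polynomials\<close>

lemma lift2_0: "lift2 0 = 0"
  by (simp add: lift2_def)

lemma lift2_pCons: "lift2 (pCons c p) = pCons [:[:c:]:] (lift2 p)"
  by (simp add: lift2_def Polynomial.map_poly_pCons)

lemma poly_lift2_varX: "poly (lift2 p) varX = [:p:]"
  by (induction p) (simp_all add: lift2_0 lift2_pCons varX_def)

lemma poly_lift2_varY: "poly (lift2 p) varY = map_poly (\<lambda>c. [:c:]) p"
  by (induction p) (simp_all add: lift2_0 lift2_pCons varY_def Polynomial.map_poly_pCons)

text \<open>In \<open>y\<close> the term \<open>f(y)\<close> has degree \<open>n\<close> and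
  \<open>f(x)\<close> is constant. The exact degree is what \<open>hom_resultant_eq_prod\<close>
  requires, as \<open>f1\<close> specialises to a product of \<open>n - 1\<close> linear
  factors.\<close>

lemma degree_divided_difference:
  assumes n: "n > 0" and f1: "(varY - varX) * f1 =
    poly (lift2 (gen_poly n)) varY - poly (lift2 (gen_poly n)) varX"
  shows "degree f1 = n - 1"
proof -
  let ?R = "poly (lift2 (gen_poly n)) varY - poly (lift2 (gen_poly n)) varX"
  have "gen_poly n \<noteq> 0"
    using coeff_gen_poly[of n n] by auto
  hence "degree (poly (lift2 (gen_poly n)) varY) = n"
    unfolding poly_lift2_varY by (subst degree_map_poly) (auto simp: degree_gen_poly coeff_gen_poly)
  hence deg: "degree ?R = n"
    unfolding poly_lift2_varX diff_conv_add_uminus using n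
    by (subst degree_add_eq_left) simp_all
  have lin: "degree (varY - varX) = 1"
    by (simp add: varX_def varY_def)
  have "f1 \<noteq> 0" using f1 deg n by auto
  hence "degree ((varY - varX) * f1) = 1 + degree f1"
    using lin by (subst degree_mult_eq) auto
  thus ?thesis using deg f1 by simp
qed

text \<open>A ring homomorphism on the coefficients of polynomials in \<open>y\<close>: it evaluates
  the inner resultant directly, and mapped over \<open>f1\<close> and \<open>f3\<close> it leaves
  complex polynomials in \<open>y\<close>.\<close>

definition eval_xa :: "(nat \<Rightarrow> complex) \<Rightarrow> complex \<Rightarrow> mpoly poly \<Rightarrow> complex" where
  "eval_xa v a p = poly (map_poly (meval v) p) a"

interpretation eval_xa: comm_ring_hom "eval_xa v a" for v a
proof -
  interpret map_poly_comm_ring_hom "meval v" ..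
  show "comm_ring_hom (eval_xa v a)"
    by unfold_locales (simp_all add: eval_xa_def hom_add hom_mult)
qed

interpretation map_eval_xa: map_poly_comm_ring_hom "eval_xa v a" for v a ..

lemma eval_xa_const: "eval_xa v a [:c:] = meval v c"
  by (simp add: eval_xa_def Polynomial.map_poly_pCons meval_0)

lemma map_poly_eval_xa_const: "map_poly (eval_xa v a) [:[:c:]:] = [:meval v c:]"
  by (simp add: Polynomial.map_poly_pCons eval_xa.hom_zero eval_xa_const)

lemma map_poly_eval_xa_lift2:
  "map_poly (eval_xa v a) (poly (lift2 p) z) =
    pcompose (map_poly (meval v) p) (map_poly (eval_xa v a) z)"
proof (induction p)
  case (pCons c p)
  thus ?case
    by (simp add: lift2_pCons Polynomial.map_poly_pCons meval_0 pcompose_pCons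
        map_eval_xa.hom_add map_eval_xa.hom_mult map_poly_eval_xa_const)
qed (simp add: lift2_0)

lemma map_poly_eval_xa_varX: "map_poly (eval_xa v a) varX = [:a:]"
  by (simp add: varX_def Polynomial.map_poly_pCons eval_xa.hom_zero)
    (simp add: eval_xa_def Polynomial.map_poly_pCons meval_0 meval_1)

lemma map_poly_eval_xa_varY: "map_poly (eval_xa v a) varY = [:0, 1:]"
  by (simp add: varY_def Polynomial.map_poly_pCons eval_xa.hom_zero eval_xa.hom_one)

lemma pcompose_const_right: "pcompose p [:a:] = [:poly p a:]"
  by (induction p) (simp_all add: pcompose_pCons mult.commute)

text \<open>At \<open>x = r i\<close> the term \<open>f(x)\<close> vanishes, and one factor
  \<open>y - r i\<close> cancels from \<open>f(y)\<close>. Cancelling polynomials and removing an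
  index, not a value, keeps repeated roots correct.\<close>

lemma divided_difference_at_root:
  fixes r :: "nat \<Rightarrow> complex"
  assumes f1: "(varY - varX) * f1 = poly (lift2 p) varY - poly (lift2 p) varX"
    and p: "map_poly (meval v) p = (\<Prod>j<n. [:- r j, 1:])" and i: "i < n"
  shows "map_poly (eval_xa v (r i)) f1 = (\<Prod>j\<in>{..<n} - {i}. [:- r j, 1:])"
proof -
  let ?q = "\<Prod>j<n. [:- r j, 1:]" and ?H = "map_poly (eval_xa v (r i))"
  have root: "poly ?q (r i) = 0" using i by (auto simp: poly_prod intro!: prod_zero)
  have "[:- r i, 1:] * ?H f1 = ?H ((varY - varX) * f1)"
    by (simp add: map_eval_xa.hom_mult map_eval_xa.hom_minus map_poly_eval_xa_varX map_poly_eval_xa_varY)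
  also have "\<dots> = ?q"
    unfolding f1 map_eval_xa.hom_minus map_poly_eval_xa_lift2 map_poly_eval_xa_varX
      map_poly_eval_xa_varY p using root
    by (simp add: pcompose_const_right)
  also have "\<dots> = [:- r i, 1:] * (\<Prod>j\<in>{..<n} - {i}. [:- r j, 1:])"
    using i by (subst prod.remove[of _ i]) auto
  finally show ?thesis
    by (subst (asm) mult_left_cancel) auto
qed

text \<open>If \<open>r i = r j\<close>, both sides of the defining equation vanish at \<open>y = r j\<close>, so the factor
  \<open>(y - r i)\<^sup>2\<close> has to be cancelled before evaluating.\<close>
lemma second_difference_at_roots:
  fixes r :: "nat \<Rightarrow> complex"
  assumes f3: "(varY - varX) ^ 2 * f3 = 2 * (poly (lift2 p) varY
      - 2 * poly (lift2 p) ([:[:Const (1/2):]:] * (varX + varY)) + poly (lift2 p) varX)"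
    and p: "map_poly (meval v) p = (\<Prod>j<n. [:- r j, 1:])" and ij: "i < n" "j < n" "i \<noteq> j"
  shows "poly (map_poly (eval_xa v (r i)) f3) (r j) =
    (\<Prod>k\<in>{..<n} - {i, j}. (r i + r j) / 2 - r k)"
proof -
  define H where "H = map_poly (eval_xa v (r i))"
  define q where "q = (\<Prod>j<n. [:- r j, 1:])"
  define h where "h = (\<Prod>k\<in>{..<n} - {i, j}. [:- r k, 1:])"
  define a b where "a = r i" and "b = r j"
  define L where "L = [:- a, 1:]"
  have "{..<n} - {i} - {j} = {..<n} - {i, j}" by auto
  hence q: "q = L * [:- b, 1:] * h"
    using ij prod.remove[of "{..<n}" i "\<lambda>j. [:- r j, 1:]"]
      prod.remove[of "{..<n} - {i}" j "\<lambda>j. [:- r j, 1:]"]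
    by (simp add: q_def h_def L_def a_def b_def mult.assoc del: mult_pCons_left)
  have h: "(\<Prod>k\<in>{..<n} - {i, j}. (r i + r j) / 2 - r k) = poly h ((a + b) / 2)"
    by (simp add: h_def poly_prod a_def b_def)
  \<comment> \<open>The midpoint \<open>(x + y) / 2\<close> at \<open>x = a\<close>, as a linear
    polynomial in \<open>y\<close>.\<close>
  have half: "H ([:[:Const (1/2):]:] * (varX + varY)) = [:a / 2, 1 / 2:]"
    unfolding H_def map_eval_xa.hom_mult map_eval_xa.hom_add map_poly_eval_xa_const
      map_poly_eval_xa_varX map_poly_eval_xa_varY
    by (simp add: meval_Const a_def of_rat_divide)
  have "L ^ 2 * H f3 = H ((varY - varX) ^ 2 * f3)"
    by (simp add: H_def L_def a_def map_eval_xa.hom_mult map_eval_xa.hom_power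
        map_eval_xa.hom_minus map_poly_eval_xa_varX map_poly_eval_xa_varY)
  also have "\<dots> = 2 * (q - 2 * pcompose q [:a / 2, 1 / 2:] + pcompose q [:a:])"
    unfolding f3 H_def map_eval_xa.hom_mult[of _ _ 2] map_eval_xa.hom_add map_eval_xa.hom_minus
      map_eval_xa.hom_mult[of _ _ 2] map_eval_xa.hom_numeral map_poly_eval_xa_lift2
      half[unfolded H_def] map_poly_eval_xa_varX map_poly_eval_xa_varY p
    by (simp add: q_def a_def)
  also have "pcompose q [:a:] = 0"
    by (simp add: q L_def pcompose_const_right algebra_simps)
  finally have eq: "L ^ 2 * H f3 = 2 * (q - 2 * pcompose q [:a / 2, 1 / 2:])" by simp
  have "poly (H f3) b = poly h ((a + b) / 2)"
  proof (cases "a = b")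
    case False
    have "(b - a) ^ 2 * poly (H f3) b = poly (L ^ 2 * H f3) b"
      by (simp add: L_def)
    also have "\<dots> = 2 * (poly q b - 2 * poly q ((a + b) / 2))"
      unfolding eq by (simp add: poly_pcompose add_divide_distrib)
    \<comment> \<open>\<open>q\<close> vanishes at \<open>b\<close>, and at the midpoint its two
      split-off factors multiply to \<open>- ((b - a) ^ 2) / 4\<close>.\<close>
    also have "\<dots> = (b - a) ^ 2 * poly h ((a + b) / 2)"
      by (simp add: q L_def field_simps power2_eq_square)
    finally show ?thesis using False by simp
  next
    case True
    have qL: "q = L * L * h"
      unfolding q L_def True ..
    \<comment> \<open>Passing to the midpoint halves the distance to \<open>a\<close>, so
      \<open>L ^ 2\<close> also divides the midpoint term and cancels. At \<open>y = a\<close> the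
      remaining \<open>2 * h - h\<close> gives the value of \<open>h\<close>.\<close>
    have "pcompose L [:a / 2, 1 / 2:] = smult (1 / 2) L"
      by (simp add: L_def pcompose_pCons)
    hence "pcompose q [:a / 2, 1 / 2:] = smult (1 / 4) (L ^ 2 * pcompose h [:a / 2, 1 / 2:])"
      by (simp add: qL pcompose_mult power2_eq_square)
    hence "L ^ 2 * H f3 = L ^ 2 * (2 * h - pcompose h [:a / 2, 1 / 2:])"
      unfolding eq by (simp add: qL power2_eq_square numeral_poly algebra_simps)
    hence "H f3 = 2 * h - pcompose h [:a / 2, 1 / 2:]"
      by (subst (asm) mult_left_cancel) (auto simp: L_def)
    thus ?thesis using True by (simp add: poly_pcompose)
  qed
  thus ?thesis unfolding h H_def a_def b_def .
qed

text \<open>The product formula is applied twice: to the roots \<open>r i\<close> of the specialised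
  \<open>f\<close>, and for each \<open>i\<close> to the roots \<open>r j\<close> with
  \<open>j \<noteq> i\<close> of \<open>f1\<close> at \<open>x = r i\<close>.\<close>

lemma meval_iterated_resultant:
  assumes n: "n > 0" and f1: "(varY - varX) * f1 =
      poly (lift2 (gen_poly n)) varY - poly (lift2 (gen_poly n)) varX"
    and f3: "(varY - varX) ^ 2 * f3 = 2 * (poly (lift2 (gen_poly n)) varY
      - 2 * poly (lift2 (gen_poly n)) ([:[:Const (1/2):]:] * (varX + varY))
      + poly (lift2 (gen_poly n)) varX)"
    and v: "\<And>i. i < n \<Longrightarrow> v i = coeff (\<Prod>j<n. [:- r j, 1:]) i"
  shows "meval v (resultant (gen_poly n) (resultant f1 f3)) =
    (\<Prod>i<n. \<Prod>j\<in>{..<n} - {i}. \<Prod>k\<in>{..<n} - {i, j}. (r i + r j) / 2 - r k)"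
proof -
  note p = map_poly_meval_gen_poly[OF v]
  have "meval v (resultant (gen_poly n) (resultant f1 f3)) =
      (\<Prod>i<n. eval_xa v (r i) (resultant f1 f3))"
    unfolding eval_xa_def
    by (rule meval.hom_resultant_eq_prod) (auto simp: degree_gen_poly p)
  also have "\<dots> = (\<Prod>i<n. \<Prod>j\<in>{..<n} - {i}. poly (map_poly (eval_xa v (r i)) f3) (r j))"
  proof (rule prod.cong[OF refl])
    fix i assume "i \<in> {..<n}"
    thus "eval_xa v (r i) (resultant f1 f3) =
        (\<Prod>j\<in>{..<n} - {i}. poly (map_poly (eval_xa v (r i)) f3) (r j))"
      using divided_difference_at_root[OF f1 p, of i] degree_divided_difference[OF n f1]
      by (intro eval_xa.hom_resultant_eq_prod) auto
  qed
  also have "\<dots> = (\<Prod>i<n. \<Prod>j\<in>{..<n} - {i}. \<Prod>k\<in>{..<n} - {i, j}. (r i + r j) / 2 - r k)"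
    by (intro prod.cong refl second_difference_at_roots[OF f3 p]) auto
  finally show ?thesis .
qed

section \<open>The product over triples of roots\<close>

definition root_triples :: "nat \<Rightarrow> (nat \<times> nat \<times> nat) set" where
  "root_triples n = {(i, j, k). i < n \<and> j < n \<and> k < n \<and> i < j \<and> j \<noteq> k \<and> k \<noteq> i}"

lemma finite_root_triples: "finite (root_triples n)"
  by (rule finite_subset[of _ "{..<n} \<times> {..<n} \<times> {..<n}"]) (auto simp: root_triples_def)

definition D2_roots :: "nat \<Rightarrow> (nat \<Rightarrow> complex) \<Rightarrow> complex" where
  "D2_roots n r = (\<Prod>(i, j, k)\<in>root_triples n. 2 * r k - r i - r j)"

text \<open>The ordered triples split into \<open>T\<close>, where \<open>i < j\<close>, and its
  mirror image \<open>T'\<close>. The factor is symmetric in \<open>i\<close> and \<open>j\<close>,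
  so both halves have the same product, and each factor is \<open>-1/2\<close> times one of
  \<open>D2_roots\<close>.\<close>

lemma prod_midpoint_differences:
  fixes r :: "nat \<Rightarrow> complex"
  shows "(\<Prod>i<n. \<Prod>j\<in>{..<n} - {i}. \<Prod>k\<in>{..<n} - {i, j}. (r i + r j) / 2 - r k) =
    of_rat ((-1/2) ^ (2 * card (root_triples n))) * D2_roots n r ^ 2"
proof -
  define T where "T = root_triples n"
  define T' where "T' = (\<lambda>(i, j, k). (j, i, k)) ` T"
  define F where "F = (\<lambda>(i, j, k). (r i + r j) / 2 - r k)"
  have fin: "finite T" "finite T'" by (auto simp: T_def T'_def finite_root_triples)
  have "(\<Prod>i<n. \<Prod>j\<in>{..<n} - {i}. \<Prod>k\<in>{..<n} - {i, j}. (r i + r j) / 2 - r k) =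
      (\<Prod>i<n. \<Prod>(j, k)\<in>(SIGMA j:{..<n} - {i}. {..<n} - {i, j}). (r i + r j) / 2 - r k)"
    by (intro prod.cong refl prod.Sigma) auto
  also have "\<dots> = prod F (SIGMA i:{..<n}. SIGMA j:{..<n} - {i}. {..<n} - {i, j})"
    unfolding F_def by (subst prod.Sigma) auto
  also have "(SIGMA i:{..<n}. SIGMA j:{..<n} - {i}. {..<n} - {i, j}) = T \<union> T'"
    by (auto simp: T_def T'_def root_triples_def image_iff)
  also have "prod F (T \<union> T') = prod F T * prod F T'"
    using fin by (intro prod.union_disjoint) (auto simp: T_def T'_def root_triples_def)
  also have "prod F T' = prod F T"
    unfolding T'_def by (subst prod.reindex) (auto simp: inj_on_def F_def add.commute intro!: prod.cong)
  also have "prod F T = (\<Prod>(i, j, k)\<in>T. (-1/2) * (2 * r k - r i - r j))"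
    by (intro prod.cong) (auto simp: F_def field_simps)
  also have "\<dots> = (-1/2) ^ card T * D2_roots n r"
    unfolding D2_roots_def T_def[symmetric]
    by (simp only: case_prod_unfold prod.distrib prod_constant)
  also have "(-1/2) ^ card T * D2_roots n r * ((-1/2) ^ card T * D2_roots n r) =
      ((-1/2) ^ card T) ^ 2 * D2_roots n r ^ 2"
    by (simp add: power2_eq_square mult_ac)
  also have "((-1/2) ^ card T) ^ 2 = complex_of_rat ((-1/2) ^ (2 * card T))"
    by (simp only: of_rat_power of_rat_divide of_rat_minus of_rat_1 of_rat_numeral_eq
        power_mult[symmetric] mult.commute)
  finally show ?thesis unfolding T_def .
qed

text \<open>A permutation may reverse the order of \<open>i\<close> and \<open>j\<close>, so
  \<open>\<psi>\<close> sorts their images again, which does not change the factor. An injective map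
  of the finite set \<open>T\<close> into itself is a bijection.\<close>

lemma D2_roots_symmetric:
  assumes \<phi>: "bij_betw \<phi> {..<n} {..<n}"
  shows "D2_roots n (r \<circ> \<phi>) = D2_roots n r"
proof -
  define T where "T = root_triples n"
  define \<psi> where "\<psi> = (\<lambda>(i, j, k). (min (\<phi> i) (\<phi> j), max (\<phi> i) (\<phi> j), \<phi> k))"
  have inj: "\<phi> i = \<phi> j \<longleftrightarrow> i = j" if "i < n" "j < n" for i j
    using \<phi> that by (auto simp: bij_betw_def inj_on_def)
  have lt: "\<phi> i < n" if "i < n" for i
    using \<phi> that by (auto simp: bij_betw_def)
  have "\<psi> (i, j, k) \<in> T" if "(i, j, k) \<in> T" for i j k
  proof -
    have *: "i < n" "j < n" "k < n" "i \<noteq> j" "j \<noteq> k" "k \<noteq> i"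
      using that by (auto simp: T_def root_triples_def)
    hence "\<phi> i \<noteq> \<phi> j" "\<phi> j \<noteq> \<phi> k" "\<phi> k \<noteq> \<phi> i" by (simp_all add: inj)
    thus ?thesis using lt[of i] lt[of j] lt[of k] *
      by (simp add: T_def root_triples_def \<psi>_def min_def max_def)
  qed
  hence sub: "\<psi> ` T \<subseteq> T" by auto
  have injT: "inj_on \<psi> T"
  proof (rule inj_onI)
    fix t t' assume t: "t \<in> T" "t' \<in> T" and eq: "\<psi> t = \<psi> t'"
    obtain i j k i' j' k' where ijk: "t = (i, j, k)" "t' = (i', j', k')"
      by (cases t, cases t') auto
    have lt: "i < n" "j < n" "k < n" "i' < n" "j' < n" "k' < n" "i < j" "i' < j'"
      using t ijk by (auto simp: T_def root_triples_def)
    have "k = k'" using eq inj lt by (simp add: ijk \<psi>_def)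
    have "min (\<phi> i) (\<phi> j) = min (\<phi> i') (\<phi> j')" "max (\<phi> i) (\<phi> j) = max (\<phi> i') (\<phi> j')"
      using eq by (simp_all add: ijk \<psi>_def)
    hence "\<phi> i = \<phi> i' \<and> \<phi> j = \<phi> j' \<or> \<phi> i = \<phi> j' \<and> \<phi> j = \<phi> i'"
      by linarith
    hence "i = i' \<and> j = j' \<or> i = j' \<and> j = i'"
      using lt by (simp add: inj)
    thus "t = t'" using lt \<open>k = k'\<close> by (auto simp: ijk)
  qed
  have "D2_roots n r = (\<Prod>(i, j, k)\<in>\<psi> ` T. 2 * r k - r i - r j)"
    unfolding D2_roots_def T_def[symmetric]
    using endo_inj_surj[OF _ sub injT] finite_root_triples by (simp add: T_def)
  also have "\<dots> = (\<Prod>t\<in>T. (\<lambda>(i, j, k). 2 * r k - r i - r j) (\<psi> t))"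
    by (subst prod.reindex[OF injT]) simp
  also have "\<dots> = D2_roots n (r \<circ> \<phi>)"
    unfolding D2_roots_def T_def[symmetric]
    by (intro prod.cong) (auto simp: \<psi>_def min_def max_def)
  finally show ?thesis ..
qed

text \<open>Each factor is written as a rational linear form in all roots, the shape that
  \<open>sym_rep_symmetric_prod\<close> expects.\<close>

lemma sym_rep_D2_roots: "sym_rep n (D2_roots n)"
proof -
  define c :: "nat \<times> nat \<times> nat \<Rightarrow> nat \<Rightarrow> rat" where
    "c = (\<lambda>(i, j, k) l. (if l = k then 2 else 0) - (if l = i then 1 else 0) - (if l = j then 1 else 0))"
  show ?thesis
  proof (rule sym_rep_symmetric_prod[where S = "root_triples n" and c = c])
    fix r :: "nat \<Rightarrow> complex"
    have lin: "(\<Sum>l<n. of_rat (c (i, j, k) l) * r l) = 2 * r k - r i - r j"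
      if "(i, j, k) \<in> root_triples n" for i j k
    proof -
      have "(\<Sum>l<n. of_rat (c (i, j, k) l) * r l) =
          (\<Sum>l<n. (if l = k then 2 * r l else 0) - (if l = i then r l else 0) - (if l = j then r l else 0))"
        by (intro sum.cong) (auto simp: c_def of_rat_diff algebra_simps)
      thus ?thesis using that by (simp add: sum_subtractf root_triples_def)
    qed
    show "D2_roots n r = (\<Prod>t\<in>root_triples n. \<Sum>i<n. of_rat (c t i) * r i)"
      unfolding D2_roots_def by (intro prod.cong) (auto simp: lin)
  qed (auto simp: finite_root_triples D2_roots_symmetric)
qed

theorem theorem3:
  fixes n :: nat and f1 f3 :: "mpoly poly poly"
  assumes n3: "n \<ge> 3"
    and f1_def: "(varY - varX) * f1 = poly (lift2 (gen_poly n)) varY - poly (lift2 (gen_poly n)) varX"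
    and f3_def: "(varY - varX) ^ 2 * f3 =
        2 * (poly (lift2 (gen_poly n)) varY
             - 2 * poly (lift2 (gen_poly n)) ([:[:Const (1/2):]:] * (varX + varY))
             + poly (lift2 (gen_poly n)) varX)"
  shows "\<exists>D2 :: mpoly.
     mvars D2 \<subseteq> {..<n} \<and>
     (\<forall>r :: nat \<Rightarrow> complex.
        meval (\<lambda>i. coeff (\<Prod>j<n. [:- r j, 1:]) i) D2 =
        (\<Prod>(i, j, k) \<in> {(i, j, k). i < n \<and> j < n \<and> k < n \<and> i < j \<and> j \<noteq> k \<and> k \<noteq> i}.
            2 * r k - r i - r j)) \<and>
     (\<exists>c :: rat. c \<noteq> 0 \<and>
        resultant (gen_poly n) (resultant f1 f3) = Const c * D2 ^ 2)"
proof -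
  define E where "E = resultant (gen_poly n) (resultant f1 f3)"
  \<comment> \<open>One factor \<open>-1/2\<close> for each ordered triple of distinct indices, of
    which there are twice as many as in \<open>root_triples n\<close>.\<close>
  define c :: rat where "c = (-1/2) ^ (2 * card (root_triples n))"
  obtain D2 where D2: "mvars D2 \<subseteq> {..<n}"
    "\<And>r. meval (\<lambda>i. coeff (\<Prod>j<n. [:- r j, 1:]) i) D2 = D2_roots n r"
    using sym_rep_D2_roots[of n] by (auto simp: sym_rep_def)
  have "meval v (E - Const c * D2 ^ 2) = 0" for v
  proof -
    \<comment> \<open>Every point comes from roots: its first \<open>n\<close> coordinates are the
      lower coefficients of the monic polynomial \<open>p\<close>, which splits over the complex
      numbers.\<close>
    define p where "p = map_poly (meval v) (gen_poly n)"
    have coeff_p: "coeff p i = (if i < n then v i else if i = n then 1 else 0)" for i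
      by (simp add: p_def coeff_gen_poly meval_Var meval_0 meval_1)
    have "degree p = n"
      by (intro antisym degree_le le_degree) (auto simp: coeff_p)
    then obtain r where r: "p = (\<Prod>j<n. [:- r j, 1:])"
      using monic_complex_poly_splits[of p] by (auto simp: coeff_p)
    have v: "v i = coeff (\<Prod>j<n. [:- r j, 1:]) i" if "i < n" for i
      using that by (simp add: r[symmetric] coeff_p)
    have "meval v E = of_rat c * D2_roots n r ^ 2"
      unfolding E_def c_def prod_midpoint_differences[symmetric]
      using n3 by (intro meval_iterated_resultant f1_def f3_def v) auto
    moreover have "meval v D2 = D2_roots n r"
      unfolding D2(2)[symmetric] using D2(1) v by (intro meval_cong_mvars) auto
    ultimately show ?thesis
      by (simp add: meval.hom_minus meval_mult meval.hom_power meval_Const)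
  qed
  hence "E = Const c * D2 ^ 2"
    using meval_eq_0_imp_eq_0[of "E - Const c * D2 ^ 2"] by simp
  moreover have "c \<noteq> 0" by (simp add: c_def)
  ultimately show ?thesis
    using D2 unfolding E_def D2_roots_def root_triples_def by blast
qed

end
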